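(* Let $X$ be a separable Fréchet space and let $T:X\to X$ be a continuous linear operator that is ultra hypercyclic. Then $T$ is weakly mixing.
   Context: Let $X$ be a separable Fréchet space and $T:X\to X$ a continuous linear map. $T$ is called ultra hypercyclic if there exists a (strictly) increasing sequence $(n_k)_{k\ge 1}$ of positive integers such that, for each non-empty open subset $U$ of $X$, $X=\bigcup_{i\ge 1}\bigcap_{k\ge i}T^{n_k}(U)$ (the sequence does not depend on $U$). For non-empty open subsets $U,V$ of $X$ let $N(U,V)=\{n\in\mathbb{N}_0: T^n(U)\cap V\neq\emptyset\}$, where $\mathbb{N}_0=\{0,1,2,\dots\}$. $T$ is called weakly mixing if for all non-empty open subsets $U,V$ of $X$ the set $N(U,V)$ contains arbitrarily long intervals (i.e. arbitrarily long finite runs of consecutive integers). *)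

theory Defs
  imports "HOL-Analysis.Analysis"
begin

text \<open>
  The scalar field is left as a type \<open>'k\<close> of class \<open>real_normed_field\<close> so that real and complex
  spaces are both covered; up to isomorphism the class has no other members, by
  Gelfand--Mazur.
\<close>

definition seminorm_on_space ::
    "('k::real_normed_field \<Rightarrow> 'a::ab_group_add \<Rightarrow> 'a) \<Rightarrow> ('a \<Rightarrow> real) \<Rightarrow> bool" where
  "seminorm_on_space smul p \<longleftrightarrow>
     (\<forall>x. 0 \<le> p x) \<and>
     (\<forall>x y. p (x + y) \<le> p x + p y) \<and>
     (\<forall>c x. p (smul c x) = norm c * p x)"

text \<open>
  A Frechet space is a vector space whose topology is generated by a separating sequence of
  seminorms for which it is complete. The sequence is not required to be increasing, so basic
  neighbourhoods use finitely many seminorms at a time. Since the seminorms are countably many,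
  completeness may be expressed with sequences.
\<close>

definition frechet_space ::
    "('k::real_normed_field \<Rightarrow> 'a::{ab_group_add, topological_space} \<Rightarrow> 'a) \<Rightarrow> bool" where
  "frechet_space smul \<longleftrightarrow>
     vector_space smul \<and>
     (\<exists>p :: nat \<Rightarrow> 'a \<Rightarrow> real.
        (\<forall>j. seminorm_on_space smul (p j)) \<and>
        (\<forall>x. (\<forall>j. p j x = 0) \<longrightarrow> x = 0) \<and>
        (\<forall>U. open U \<longleftrightarrow>
              (\<forall>x\<in>U. \<exists>e>0. \<exists>m. {y. \<forall>j\<le>m. p j (y - x) < e} \<subseteq> U)) \<and>
        (\<forall>X :: nat \<Rightarrow> 'a.
           (\<forall>j. \<forall>e>0. \<exists>M. \<forall>r\<ge>M. \<forall>s\<ge>M. p j (X r - X s) < e) \<longrightarrow> (\<exists>x. X \<longlonglongrightarrow> x)))"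

text \<open>Sequences are indexed from 1: the value of \<open>n\<close> at 0 is irrelevant.\<close>

definition ultra_hypercyclic :: "('a::topological_space \<Rightarrow> 'a) \<Rightarrow> bool" where
  "ultra_hypercyclic T \<longleftrightarrow>
     (\<exists>n :: nat \<Rightarrow> nat.
        strict_mono_on {1..} n \<and> (\<forall>k\<ge>1. 0 < n k) \<and>
        (\<forall>U. open U \<and> U \<noteq> {} \<longrightarrow> UNIV = (\<Union>i\<in>{1..}. \<Inter>k\<in>{i..}. (T ^^ n k) ` U)))"

definition return_set :: "('a \<Rightarrow> 'a) \<Rightarrow> 'a set \<Rightarrow> 'a set \<Rightarrow> nat set" where
  "return_set T U V = {n. (T ^^ n) ` U \<inter> V \<noteq> {}}"

definition weakly_mixing :: "('a::topological_space \<Rightarrow> 'a) \<Rightarrow> bool" where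
  "weakly_mixing T \<longleftrightarrow>
     (\<forall>U V. open U \<and> U \<noteq> {} \<and> open V \<and> V \<noteq> {} \<longrightarrow>
        (\<forall>L. \<exists>m. {m..<m + L} \<subseteq> return_set T U V))"

end

theory Submission
  imports Defs
begin

text \<open>
  Ultra hypercyclicity makes \<open>T\<close> surjective, so a point \<open>v\<close> of the target set \<open>V\<close> has a preimage
  \<open>y j\<close> under each \<open>T ^^ j\<close>. Each of the points \<open>y 0\<close>, ..., \<open>y (L - 1)\<close> lies in \<open>(T ^^ n k) ` U\<close> for
  all large \<open>k\<close>, hence so do all of them for one common \<open>k\<close>. Applying \<open>T ^^ j\<close> to
  \<open>y j\<close> then puts \<open>v\<close> into \<open>(T ^^ (n k + j)) ` U\<close> for every \<open>j < L\<close>, so an interval of length \<open>L\<close>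
  starting at \<open>n k\<close> consists of return times.
\<close>

lemma ultra_hypercyclicE:
  assumes "ultra_hypercyclic T"
  obtains n :: "nat \<Rightarrow> nat" where
    "\<And>k. 1 \<le> k \<Longrightarrow> 0 < n k"
    "\<And>U x. open U \<Longrightarrow> U \<noteq> {} \<Longrightarrow> \<forall>\<^sub>F k in sequentially. x \<in> (T ^^ n k) ` U"
proof -
  from assms obtain n :: "nat \<Rightarrow> nat" where pos: "\<forall>k\<ge>1. 0 < n k"
    and cover: "\<forall>U. open U \<and> U \<noteq> {} \<longrightarrow> UNIV = (\<Union>i\<in>{1..}. \<Inter>k\<in>{i..}. (T ^^ n k) ` U)"
    unfolding ultra_hypercyclic_def by blast
  have "\<forall>\<^sub>F k in sequentially. x \<in> (T ^^ n k) ` U" if "open U" "U \<noteq> {}" for U x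
  proof -
    have "x \<in> (\<Union>i\<in>{1..}. \<Inter>k\<in>{i..}. (T ^^ n k) ` U)"
      using cover that by blast
    then show ?thesis
      unfolding eventually_sequentially by blast
  qed
  with pos that show thesis by blast
qed

text \<open>Already the image of the whole space under a single positive power of \<open>T\<close> captures any
  given point, and that image is contained in the range of \<open>T\<close>.\<close>

lemma ultra_hypercyclic_imp_surj:
  assumes "ultra_hypercyclic T"
  shows "surj T"
proof -
  obtain n :: "nat \<Rightarrow> nat" where pos: "\<And>k. 1 \<le> k \<Longrightarrow> 0 < n k"
    and reach: "\<And>U x. open U \<Longrightarrow> U \<noteq> {} \<Longrightarrow> \<forall>\<^sub>F k in sequentially. x \<in> (T ^^ n k) ` U"
    using ultra_hypercyclicE[OF assms] by metis
  have "x \<in> range T" for x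
  proof -
    have "\<forall>\<^sub>F k in sequentially. x \<in> range (T ^^ n k) \<and> 1 \<le> k"
      using reach[of UNIV x] eventually_ge_at_top[of 1] by (auto intro: eventually_conj)
    then obtain k where k: "x \<in> range (T ^^ n k)" "1 \<le> k"
      using eventually_happens'[OF sequentially_bot] by blast
    from pos[OF k(2)] obtain m where "n k = Suc m"
      using gr0_implies_Suc by blast
    with k(1) show ?thesis by auto
  qed
  then show ?thesis by blast
qed

lemma ultra_hypercyclic_imp_weakly_mixing:
  assumes "ultra_hypercyclic T"
  shows "weakly_mixing T"
  unfolding weakly_mixing_def
proof (intro allI impI)
  fix U V :: "'a set" and L :: nat
  assume UV: "open U \<and> U \<noteq> {} \<and> open V \<and> V \<noteq> {}"
  then obtain v where v: "v \<in> V" by blast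
  obtain n :: "nat \<Rightarrow> nat" where
    reach: "\<And>U x. open U \<Longrightarrow> U \<noteq> {} \<Longrightarrow> \<forall>\<^sub>F k in sequentially. x \<in> (T ^^ n k) ` U"
    using ultra_hypercyclicE[OF assms] by metis
  have "surj (T ^^ j)" for j
    using ultra_hypercyclic_imp_surj[OF assms] by (rule surj_fn)
  then have "\<forall>j. \<exists>y. (T ^^ j) y = v" by (metis surjD)
  then obtain y where y: "\<And>j. (T ^^ j) (y j) = v" by metis
  have "\<forall>\<^sub>F k in sequentially. \<forall>j\<in>{..<L}. y j \<in> (T ^^ n k) ` U"
    using reach UV by (intro eventually_ball_finite) auto
  then obtain k where k: "\<And>j. j < L \<Longrightarrow> y j \<in> (T ^^ n k) ` U"
    using eventually_happens'[OF sequentially_bot] by blast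
  have "n k + j \<in> return_set T U V" if j: "j < L" for j
  proof -
    from k[OF j] obtain u where "u \<in> U" "y j = (T ^^ n k) u" by blast
    moreover from this have "(T ^^ (n k + j)) u = v"
      using y[of j] by (simp add: add.commute[of "n k"] funpow_add)
    ultimately show ?thesis
      using v unfolding return_set_def by blast
  qed
  then have "{n k..<n k + L} \<subseteq> return_set T U V"
    by (metis add_less_cancel_left atLeastLessThan_iff le_Suc_ex subsetI)
  then show "\<exists>m. {m..<m + L} \<subseteq> return_set T U V" ..
qed

theorem proposition2p3:
  fixes smul :: "'k::real_normed_field \<Rightarrow> 'a::{ab_group_add, topological_space} \<Rightarrow> 'a"
    and T :: "'a \<Rightarrow> 'a"
  assumes "frechet_space smul"
    and "separable_space (euclidean :: 'a topology)"
    and "Vector_Spaces.linear smul smul T"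
    and "continuous_on UNIV T"
    and "ultra_hypercyclic T"
  shows "weakly_mixing T"
  using \<open>ultra_hypercyclic T\<close> by (rule ultra_hypercyclic_imp_weakly_mixing)

end
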